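(* Let $k \ge 0$ be an integer, and let $H$, $U$, $E$, $\nabla E$, $L$, $\nabla_{\mathrm d}E$, $u_0$, the temporal mesh $0=t_0<t_1<\dots<t_N=T$, $J_n=(t_{n-1},t_n]$ and $V_\tau$ be as in the context. Assume that the following numerical scheme has a unique solution: find $(u_\tau,p_\tau)\in V_\tau\times V_\tau$ such that $u_\tau^0=u_0$ and, for every $n=1,2,\dots,N$, $$\int_{J_n}\langle \dot u_\tau, v\rangle\,dt+\big\langle [u_\tau]^{n-1}, v^{n-1,+}\big\rangle=\int_{J_n}\langle L(u_\tau)p_\tau, v\rangle\,dt\qquad \text{for all } v\in \mathcal P^k(J_n;H),$$ $$\int_{J_n}\langle p_\tau,w\rangle\,dt=\int_{J_n}\langle\nabla E(u_\tau),w\rangle\,dt\qquad\text{for all } w\in\mathcal P^{k-1}(J_n;H),$$ $$p_\tau^{n-1,+}=\nabla_{\mathrm d}E\big(u_\tau^{n-1,+},u_\tau^{n-1}\big).$$ Let $(u_\tau,p_\tau)\in V_\tau\times V_\tau$ be the solution. Then, for each $n=1,\dots,N$, $$E[u_\tau^n]-E[u_\tau^{n-1}]=\int_{J_n}\langle L(u_\tau)p_\tau,p_\tau\rangle\,dt.$$ In particular, if $L(v)$ is skew-symmetric for all $v\in H$, then the energy conservation $E[u_\tau^n]=E[u_\tau^{n-1}]$ holds for each $n$; and if $L(v)$ is negative semi-definite for all $v\in H$, then the energy dissipation $E[u_\tau^n]\le E[u_\tau^{n-1}]$ holds for each $n$.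
   Context: Setting. $H$ is a real or complex Hilbert space with inner product $\langle\cdot,\cdot\rangle$; $U\subset H$ is open; $E\colon U\to\mathbb R$ is a real-valued energy functional (its value at $u$ is written $E[u]$); $\nabla E\colon U\to H$ is the Fréchet derivative of $E$, identified with an element of $H$ through the inner product, so that the chain rule $\frac{d}{dt}E[u(t)]=\langle\nabla E(u(t)),\dot u(t)\rangle$ holds for differentiable curves $u$ in $U$. For each $v\in H$, $L(v)$ is a linear operator on $H$, which may be unbounded and may depend on $v$. $T>0$ and $u_0\in H$ are given. The scheme discretizes the gradient system $\dot u(t)=L(u(t))\nabla E(u(t))$ for $0<t\le T$, $u(0)=u_0$. Discrete gradient. A map $\nabla_{\mathrm d}E\colon U\times U\to H$ is called a discrete gradient of $E$ if (i) $E[u]-E[v]=\langle\nabla_{\mathrm d}E(u,v),u-v\rangle$ for all $u,v\in U$, and (ii) $\nabla_{\mathrm d}E(u,u)=\nabla E(u)$ for all $u\in U$. A discrete gradient $\nabla_{\mathrm d}E$ of $E$ is fixed. Mesh and function spaces. $0=t_0<t_1<\dots<t_N=T$ is a temporal mesh and $J_n=(t_{n-1},t_n]$ for $n=1,\dots,N$. For an integer $k\ge0$, $\mathcal P^k(J_n;H)=\{\sum_{j=0}^k v_jt^j : v_j\in H,\ t\in J_n\}$ is the space of $H$-valued polynomials of degree at most $k$ on $J_n$, with $\mathcal P^{-1}(J_n;H)=\{0\}$. Also $V_\tau=\{v\in L^2(0,T;H): v|_{J_n}\in\mathcal P^k(J_n;H)\text{ for all }n\}$. Nodal values and jumps. For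 $v\in V_\tau$, $v^n=v(t_n)$ (the value at the right endpoint of the polynomial piece on $J_n$, for $n\ge1$), $v^{n,+}=\lim_{t\downarrow t_n}v(t)$, and $[v]^n=v^{n,+}-v^n$. For a polynomial $v\in\mathcal P^k(J_n;H)$, $v^{n-1,+}=\lim_{t\downarrow t_{n-1}}v(t)$. The value $u_\tau^0$ is not determined by $u_\tau|_{J_1}$; it is prescribed by $u_\tau^0=u_0$. The derivative $\dot u_\tau$ is the time derivative taken piecewise on each $J_n$. Being a solution of the scheme includes that all expressions in it are meaningful: $u_0\in U$, $u_\tau(t)\in U$ for $t \in J_n$ and $u_\tau^{n-1,+}\in U$ for all $n$, $L(u_\tau)p_\tau$ is defined, and the integrals exist. *)

theory Defs
  imports "HOL-Analysis.Analysis"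
begin

text \<open>
  The scalar field of a Hilbert space.  A finite-dimensional real normed field is (a copy of) the
  real or the complex numbers, and the axioms below force the conjugation to be the usual one, so
  the class has no models other than these two.
\<close>

class real_or_complex = real_normed_field + euclidean_space +
  fixes scalar_conj :: "'a \<Rightarrow> 'a"
  assumes scalar_conj_add: "scalar_conj (x + y) = scalar_conj x + scalar_conj y"
    and scalar_conj_mult: "scalar_conj (x * y) = scalar_conj x * scalar_conj y"
    and scalar_conj_scaleR_one: "scalar_conj (r *\<^sub>R 1) = r *\<^sub>R 1"
    and mult_scalar_conj: "x * scalar_conj x = (norm x)\<^sup>2 *\<^sub>R 1"

instantiation real :: real_or_complex
begin
definition scalar_conj_real :: "real \<Rightarrow> real" where "scalar_conj_real x = x"
instance by standard (auto simp: scalar_conj_real_def power2_eq_square)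
end

instantiation complex :: real_or_complex
begin
definition scalar_conj_complex :: "complex \<Rightarrow> complex" where "scalar_conj_complex = cnj"
instance
proof
  fix x :: complex
  show "x * scalar_conj x = (norm x)\<^sup>2 *\<^sub>R 1"
    by (simp only: scalar_conj_complex_def complex_norm_square[symmetric] scaleR_conv_of_real mult_1_right)
qed (simp_all add: scalar_conj_complex_def)
end

text \<open>
  The type class \<open>banach\<close> provides the complete norm topology; the axioms say that the norm
  comes from the inner product, which is linear in the first argument.
\<close>

locale hilbert_space = vector_space smul
  for smul :: "'k::real_or_complex \<Rightarrow> 'h::banach \<Rightarrow> 'h" +
  fixes ip :: "'h \<Rightarrow> 'h \<Rightarrow> 'k"
  assumes smul_of_real: "smul (of_real r) x = r *\<^sub>R x"
    and ip_add_left: "ip (x + y) z = ip x z + ip y z"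
    and ip_smul_left: "ip (smul a x) y = a * ip x y"
    and ip_conj: "ip y x = scalar_conj (ip x y)"
    and ip_self: "ip x x = of_real ((norm x)\<^sup>2)"

lemma hilbert_space_real_inner:
  "hilbert_space (*\<^sub>R) ((\<bullet>) :: 'h::{real_inner,banach} \<Rightarrow> 'h \<Rightarrow> real)"
proof unfold_locales
  fix x y :: 'h
  show "y \<bullet> x = scalar_conj (x \<bullet> y)"
    by (simp add: scalar_conj_real_def inner_commute)
  show "x \<bullet> x = of_real ((norm x)\<^sup>2)"
    by (simp add: power2_norm_eq_inner)
qed (simp_all add: inner_add_left scaleR_add_left scaleR_add_right)

lemma hilbert_space_complex: "hilbert_space (*) (\<lambda>x y::complex. x * cnj y)"
proof unfold_locales
  fix x :: complex
  show "x * cnj x = of_real ((norm x)\<^sup>2)"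
    by (rule complex_norm_square[symmetric])
qed (simp_all add: ring_distribs scalar_conj_complex_def scaleR_conv_of_real)

text \<open>
  A complex Hilbert space is also a real one, with inner product \<open>Re \<langle>x, y\<rangle>\<close>.  A
  real-valued functional on a complex Hilbert space can only have a nonzero gradient with respect
  to this real inner product, so that energies on complex spaces are usually treated through this
  instance.
\<close>

lemma hilbert_space_Re:
  fixes smul :: "complex \<Rightarrow> 'h::banach \<Rightarrow> 'h"
  assumes "hilbert_space smul ip"
  shows "hilbert_space (*\<^sub>R) (\<lambda>x y. Re (ip x y))"
proof -
  interpret hilbert_space smul ip by fact
  show ?thesis
  proof unfold_locales
    fix a :: real and x y :: 'h
    show "Re (ip (a *\<^sub>R x) y) = a * Re (ip x y)"
      using ip_smul_left[of "of_real a" x y] by (simp add: smul_of_real)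
    show "Re (ip y x) = scalar_conj (Re (ip x y))"
      by (subst ip_conj) (simp add: scalar_conj_real_def scalar_conj_complex_def)
  qed (simp_all add: ip_add_left ip_self scaleR_add_left scaleR_add_right)
qed

text \<open>Possibly unbounded operators: \<open>D\<close> is the domain and \<open>A\<close> is relevant only on \<open>D\<close>.\<close>

definition linear_operator :: "('k::field \<Rightarrow> 'h::ab_group_add \<Rightarrow> 'h) \<Rightarrow> 'h set \<Rightarrow> ('h \<Rightarrow> 'h) \<Rightarrow> bool"
  where "linear_operator smul D A \<longleftrightarrow>
    module.subspace smul D \<and>
    (\<forall>x\<in>D. \<forall>y\<in>D. A (x + y) = A x + A y) \<and>
    (\<forall>a. \<forall>x\<in>D. A (smul a x) = smul a (A x))"

definition skew_symmetric_operator :: "('h \<Rightarrow> 'h \<Rightarrow> 'k::real_or_complex) \<Rightarrow> 'h set \<Rightarrow> ('h \<Rightarrow> 'h) \<Rightarrow> bool"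
  where "skew_symmetric_operator ip D A \<longleftrightarrow> (\<forall>x\<in>D. \<forall>y\<in>D. ip (A x) y = - ip x (A y))"

definition neg_semidef_operator :: "('h \<Rightarrow> 'h \<Rightarrow> 'k::real_or_complex) \<Rightarrow> 'h set \<Rightarrow> ('h \<Rightarrow> 'h) \<Rightarrow> bool"
  where "neg_semidef_operator ip D A \<longleftrightarrow> (\<forall>x\<in>D. \<exists>r\<le>0. ip (A x) x = of_real r)"

definition is_gradient ::
  "('h \<Rightarrow> 'h \<Rightarrow> 'k::real_or_complex) \<Rightarrow> 'h::banach set \<Rightarrow> ('h \<Rightarrow> real) \<Rightarrow> ('h \<Rightarrow> 'h) \<Rightarrow> bool"
  where "is_gradient ip U E gradE \<longleftrightarrow>
    (\<forall>u\<in>U. \<exists>E'. (E has_derivative E') (at u) \<and> (\<forall>h. of_real (E' h) = ip (gradE u) h))"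

definition discrete_gradient ::
  "('h \<Rightarrow> 'h \<Rightarrow> 'k::real_or_complex) \<Rightarrow> 'h::banach set \<Rightarrow> ('h \<Rightarrow> real) \<Rightarrow> ('h \<Rightarrow> 'h) \<Rightarrow>
    ('h \<Rightarrow> 'h \<Rightarrow> 'h) \<Rightarrow> bool"
  where "discrete_gradient ip U E gradE dgradE \<longleftrightarrow>
    (\<forall>u\<in>U. \<forall>v\<in>U. of_real (E u - E v) = ip (dgradE u v) (u - v)) \<and>
    (\<forall>u\<in>U. dgradE u u = gradE u)"

definition mesh :: "real \<Rightarrow> nat \<Rightarrow> (nat \<Rightarrow> real) \<Rightarrow> bool"
  where "mesh T N t \<longleftrightarrow> t 0 = 0 \<and> t N = T \<and> strict_mono_on {0..N} t"

definition mesh_interval :: "(nat \<Rightarrow> real) \<Rightarrow> nat \<Rightarrow> real set"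
  where "mesh_interval t n = {t (n - 1)<..t n}"

text \<open>
  Functions agreeing on \<open>J\<close> with a polynomial of degree at most \<open>q\<close>.  The degree is an
  integer; for \<open>q = -1\<close> the sum is empty and the functions vanish on \<open>J\<close>.
\<close>

definition poly_on :: "int \<Rightarrow> real set \<Rightarrow> (real \<Rightarrow> 'h::real_vector) set"
  where "poly_on q J = {v. \<exists>c. \<forall>s\<in>J. v s = (\<Sum>j<nat (q + 1). s ^ j *\<^sub>R c j)}"

text \<open>
  The space \<open>V\<^sub>\<tau>\<close>.  Elements are functions on \<open>(0,T]\<close>, hence extensional, so that equality
  of functions is equality in \<open>V\<^sub>\<tau>\<close>.  Piecewise polynomials are bounded, so membership in
  \<open>L\<^sup>2(0,T;H)\<close> is automatic.
\<close>

definition dg_space :: "nat \<Rightarrow> nat \<Rightarrow> (nat \<Rightarrow> real) \<Rightarrow> (real \<Rightarrow> 'h::real_vector) set"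
  where "dg_space k N t =
    {v \<in> extensional {t 0<..t N}. \<forall>n\<in>{1..N}. v \<in> poly_on (int k) (mesh_interval t n)}"

definition right_limit :: "(real \<Rightarrow> 'h::t2_space) \<Rightarrow> real \<Rightarrow> 'h"
  where "right_limit v s = Lim (at_right s) v"

text \<open>The nodal values \<open>u\<^sup>n\<close>, with the prescribed value \<open>u0\<close> at \<open>n = 0\<close>.\<close>

definition nodal :: "(nat \<Rightarrow> real) \<Rightarrow> 'h \<Rightarrow> (real \<Rightarrow> 'h) \<Rightarrow> nat \<Rightarrow> 'h"
  where "nodal t u0 u n = (if n = 0 then u0 else u (t n))"

definition jump :: "(nat \<Rightarrow> real) \<Rightarrow> 'h::real_normed_vector \<Rightarrow> (real \<Rightarrow> 'h) \<Rightarrow> nat \<Rightarrow> 'h"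
  where "jump t u0 u n = right_limit u (t n) - nodal t u0 u n"

text \<open>
  \<open>D v\<close> is the domain of \<open>L v\<close>.  The condition \<open>u\<^sup>0 = u0\<close> is built into \<open>nodal\<close>.
\<close>

definition dg_solution ::
  "('h \<Rightarrow> 'h \<Rightarrow> 'k::real_or_complex) \<Rightarrow> 'h::banach set \<Rightarrow> ('h \<Rightarrow> 'h) \<Rightarrow> ('h \<Rightarrow> 'h \<Rightarrow> 'h) \<Rightarrow>
    ('h \<Rightarrow> 'h set) \<Rightarrow> ('h \<Rightarrow> 'h \<Rightarrow> 'h) \<Rightarrow> nat \<Rightarrow> nat \<Rightarrow> (nat \<Rightarrow> real) \<Rightarrow> 'h \<Rightarrow>
    (real \<Rightarrow> 'h) \<Rightarrow> (real \<Rightarrow> 'h) \<Rightarrow> bool"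
  where "dg_solution ip U gradE dgradE D L k N t u0 u p \<longleftrightarrow>
    u \<in> dg_space k N t \<and> p \<in> dg_space k N t \<and> u0 \<in> U \<and>
    (\<forall>n\<in>{1..N}.
      let J = mesh_interval t n; u' = (\<lambda>s. vector_derivative u (at s within J)) in
      (\<forall>s\<in>J. u s \<in> U \<and> p s \<in> D (u s)) \<and>
      right_limit u (t (n - 1)) \<in> U \<and>
      (\<forall>v\<in>poly_on (int k) J.
        set_integrable lebesgue J (\<lambda>s. ip (u' s) (v s)) \<and>
        set_integrable lebesgue J (\<lambda>s. ip (L (u s) (p s)) (v s)) \<and>
        (LINT s:J|lebesgue. ip (u' s) (v s))
            + ip (jump t u0 u (n - 1)) (right_limit v (t (n - 1)))
          = (LINT s:J|lebesgue. ip (L (u s) (p s)) (v s))) \<and>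
      (\<forall>w\<in>poly_on (int k - 1) J.
        set_integrable lebesgue J (\<lambda>s. ip (p s) (w s)) \<and>
        set_integrable lebesgue J (\<lambda>s. ip (gradE (u s)) (w s)) \<and>
        (LINT s:J|lebesgue. ip (p s) (w s)) = (LINT s:J|lebesgue. ip (gradE (u s)) (w s))) \<and>
      right_limit p (t (n - 1)) = dgradE (right_limit u (t (n - 1))) (nodal t u0 u (n - 1)))"

end

theory Submission
  imports Defs
begin

text \<open>
  Since \<open>u'\<close> has degree at most \<open>k - 1\<close> on \<open>J\<^sub>n\<close>, the second equation may be
  tested with \<open>u'\<close> and the first one with \<open>p\<close>.  The chain rule gives
  \<open>\<integral> \<langle>p, u'\<rangle> = \<integral> \<langle>\<nabla>E(u), u'\<rangle> = E(u\<^sup>n) - E(u\<^sup>n\<^sup>-\<^sup>1\<^sup>,\<^sup>+)\<close>, and the discrete gradient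
  accounts for the jump \<open>E(u\<^sup>n\<^sup>-\<^sup>1\<^sup>,\<^sup>+) - E(u\<^sup>n\<^sup>-\<^sup>1)\<close>.  Over the complex numbers the two pairings
  appear conjugated in the first equation; their sum is real, so conjugation does no harm.
\<close>

section \<open>Conjugation and real parts on the scalar field\<close>

lemma bounded_linear_scalar_conj: "bounded_linear (scalar_conj :: 'k::real_or_complex \<Rightarrow> 'k)"
proof -
  have "scalar_conj (r *\<^sub>R x) = r *\<^sub>R scalar_conj x" for r and x :: 'k
    using scalar_conj_mult[of "r *\<^sub>R 1" x] by (simp add: scalar_conj_scaleR_one)
  then have "linear (scalar_conj :: 'k \<Rightarrow> 'k)"
    by (intro linearI) (simp_all add: scalar_conj_add)
  then show ?thesis
    by (simp add: linear_conv_bounded_linear)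
qed

lemma scalar_conj_of_real: "scalar_conj (of_real r :: 'k::real_or_complex) = of_real r"
  by (simp add: of_real_def scalar_conj_scaleR_one)

text \<open>Since \<open>z * scalar_conj z\<close> is a real multiple of 1, conjugation fixes it;
  cancelling the factor \<open>scalar_conj z\<close> gives the involution. If that factor vanishes,
  so does \<open>z\<close>.\<close>

lemma scalar_conj_scalar_conj: "scalar_conj (scalar_conj z) = (z :: 'k::real_or_complex)"
proof (cases "scalar_conj z = 0")
  case True
  then have "z = 0"
    using mult_scalar_conj[of z] by simp
  then show ?thesis
    using scalar_conj_of_real[of 0, where 'k = 'k] by simp
next
  case False
  have "scalar_conj z * scalar_conj (scalar_conj z) = scalar_conj (z * scalar_conj z)"
    by (simp add: scalar_conj_mult)
  also have "\<dots> = z * scalar_conj z"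
    by (simp only: mult_scalar_conj scalar_conj_scaleR_one)
  finally show ?thesis
    using False by (simp add: mult.commute)
qed

text \<open>Used with \<open>scalar_conj\<close>, its negative and the inner product with 1, which
  are real-linear but in general not linear over the scalar field.\<close>

lemma set_integral_bounded_linear:
  fixes f :: "'a \<Rightarrow> 'b::{banach, second_countable_topology}"
    and h :: "'b \<Rightarrow> 'c::{banach, second_countable_topology}"
  assumes "bounded_linear h" "set_integrable M A f"
  shows "(LINT x:A|M. h (f x)) = h (LINT x:A|M. f x)"
proof -
  interpret bounded_linear h by fact
  show ?thesis
    using integral_bounded_linear[OF assms(1), of M "\<lambda>x. indicator A x *\<^sub>R f x"] assms(2)
    by (simp add: set_integrable_def set_lebesgue_integral_def scaleR)
qed

text \<open>The map \<open>z \<bullet> 1\<close> plays the role of the real part on the abstract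
  scalar field: it sends \<open>of_real r\<close> to \<open>r\<close>, which turns the claim into
  one about a real integral.\<close>

lemma of_real_eq_set_integral_nonpos:
  fixes x :: real and f :: "'a \<Rightarrow> 'k::real_or_complex"
  assumes int: "set_integrable M A f"
    and eq: "of_real x = (LINT s:A|M. f s)"
    and nonpos: "\<And>s. s \<in> A \<Longrightarrow> \<exists>r\<le>0. f s = of_real r"
  shows "x \<le> 0"
proof -
  have re: "of_real r \<bullet> (1::'k) = r" for r
    by (simp add: of_real_def norm_eq_1[symmetric])
  have "x = (LINT s:A|M. f s \<bullet> 1)"
    using set_integral_bounded_linear[OF bounded_linear_inner_left[of 1] int]
    by (simp add: eq[symmetric] re)
  also have "\<dots> = - (LINT s|M. - (indicator A s *\<^sub>R (f s \<bullet> 1)))"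
    by (simp add: set_lebesgue_integral_def)
  also have "\<dots> \<le> 0"
  proof -
    have "0 \<le> (LINT s|M. - (indicator A s *\<^sub>R (f s \<bullet> 1)))"
      by (intro Bochner_Integration.integral_nonneg)
        (auto simp: indicator_def re dest!: nonpos)
    then show ?thesis by simp
  qed
  finally show ?thesis .
qed

section \<open>Polynomial pieces: derivatives and right limits\<close>

text \<open>Membership in \<open>poly_on\<close> constrains \<open>v\<close> on \<open>J\<close>
  only. Extending the polynomial to the whole line gives two-sided derivatives even at the
  endpoints, and the drop in degree makes \<open>q'\<close> an admissible test function in the
  second equation.\<close>

lemma poly_on_extension:
  assumes "v \<in> poly_on (int k) J"
  obtains q q' where "\<And>s. s \<in> J \<Longrightarrow> v s = q s"
    and "\<And>s. (q has_vector_derivative q' s) (at s)"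
    and "q' \<in> poly_on (int k - 1) J"
proof -
  from assms obtain c where c: "\<And>s. s \<in> J \<Longrightarrow> v s = (\<Sum>j<Suc k. s ^ j *\<^sub>R c j)"
    by (auto simp: poly_on_def nat_add_distrib)
  define q where "q s = (\<Sum>j<Suc k. s ^ j *\<^sub>R c j)" for s :: real
  define q' where "q' s = (\<Sum>j<k. s ^ j *\<^sub>R (real (Suc j) *\<^sub>R c (Suc j)))" for s :: real
  have "(q has_vector_derivative q' s) (at s)" for s
  proof -
    have "((\<lambda>s. \<Sum>j<Suc k. s ^ j *\<^sub>R c j) has_vector_derivative
        (\<Sum>j<Suc k. (real j * s ^ (j - 1)) *\<^sub>R c j)) (at s)"
    proof (intro has_vector_derivative_sum)
      fix j
      have "((\<lambda>s. s ^ j) has_real_derivative real j * s ^ (j - 1)) (at s)"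
        by (auto intro!: derivative_eq_intros)
      from has_vector_derivative_scaleR[OF this has_vector_derivative_const[of "c j"]]
      show "((\<lambda>s. s ^ j *\<^sub>R c j) has_vector_derivative (real j * s ^ (j - 1)) *\<^sub>R c j) (at s)"
        by simp
    qed
    \<comment> \<open>The term for \<open>j = 0\<close> vanishes, so shifting the index leaves
      \<open>k\<close> terms; for \<open>k = 0\<close> the sum is empty, in agreement with degree
      -1.\<close>
    also have "(\<Sum>j<Suc k. (real j * s ^ (j - 1)) *\<^sub>R c j) = q' s"
      by (subst sum.lessThan_Suc_shift) (simp add: q'_def mult.commute)
    finally show ?thesis
      by (simp add: q_def[abs_def])
  qed
  moreover have "q' \<in> poly_on (int k - 1) J"
    by (auto simp: poly_on_def q'_def intro!: exI[of _ "\<lambda>j. real (Suc j) *\<^sub>R c (Suc j)"])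
  ultimately show ?thesis
    using that[of q q'] c by (simp add: q_def)
qed

lemma vector_derivative_within_greaterThanAtMost:
  fixes v q :: "real \<Rightarrow> 'h::real_normed_vector"
  assumes "s \<in> {a<..b}" and eq: "\<And>r. r \<in> {a<..b} \<Longrightarrow> v r = q r"
    and "(q has_vector_derivative d) (at s)"
  shows "vector_derivative v (at s within {a<..b}) = d"
proof (rule vector_derivative_within)
  \<comment> \<open>Points to the left of \<open>s\<close> always lie in the interval, so the
    derivative within it is unique even at \<open>s = b\<close>.\<close>
  have "s islimpt {a<..<s}"
    using assms(1) by (simp add: islimpt_greaterThanLessThan2)
  then have "s islimpt {a<..b}"
    by (rule islimpt_subset) (use assms(1) in auto)
  then show "at s within {a<..b} \<noteq> bot"
    by (simp add: trivial_limit_within)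
  show "(v has_vector_derivative d) (at s within {a<..b})"
    by (rule has_vector_derivative_transform[of s _ _ q])
      (use assms in \<open>auto intro: has_vector_derivative_at_within\<close>)
qed

text \<open>The limit sees only points to the right of \<open>a\<close>. The value
  \<open>v a\<close> belongs to the preceding piece, or is unspecified at time 0, and does not
  enter.\<close>

lemma right_limit_eq:
  fixes v q :: "real \<Rightarrow> 'h::t2_space"
  assumes "a < b" "\<And>s. s \<in> {a<..b} \<Longrightarrow> v s = q s" "isCont q a"
  shows "right_limit v a = q a"
proof -
  have "(q \<longlongrightarrow> q a) (at_right a)"
    using assms(3) by (simp add: isCont_def filterlim_at_split)
  moreover have "\<forall>\<^sub>F s in at_right a. q s = v s"
    using eventually_at_right_real[OF assms(1)] by eventually_elim (use assms(2) in auto)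
  ultimately have "(v \<longlongrightarrow> q a) (at_right a)"
    by (simp cong: tendsto_cong)
  then show ?thesis
    by (simp add: right_limit_def tendsto_Lim)
qed

section \<open>The chain rule in integrated form\<close>

text \<open>This is the fundamental theorem of calculus for \<open>E (q s)\<close>. The gauge
  integral is used because \<open>gradE\<close> may be discontinuous, while a derivative is always
  gauge-integrable.\<close>

lemma has_integral_gradient:
  fixes ip :: "'h::banach \<Rightarrow> 'h \<Rightarrow> 'k::real_or_complex"
  assumes grad: "is_gradient ip U E gradE" and "a \<le> b"
    and q: "\<And>s. (q has_vector_derivative q' s) (at s)"
    and U: "\<And>s. s \<in> {a..b} \<Longrightarrow> q s \<in> U"
  shows "((\<lambda>s. ip (gradE (q s)) (q' s)) has_integral of_real (E (q b) - E (q a))) {a..b}"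
proof -
  have "((\<lambda>s. of_real (E (q s)) :: 'k) has_vector_derivative ip (gradE (q s)) (q' s))
      (at s within {a..b})" if s: "s \<in> {a..b}" for s
  proof -
    obtain E' where E': "(E has_derivative E') (at (q s))"
      and ip: "\<And>h. of_real (E' h) = ip (gradE (q s)) h"
      using grad U[OF s] unfolding is_gradient_def by blast
    interpret E': bounded_linear E'
      using E' by (rule has_derivative_bounded_linear)
    have "((\<lambda>s. E (q s)) has_derivative (\<lambda>x. E' (x *\<^sub>R q' s))) (at s)"
      using diff_chain_at[OF q[of s, unfolded has_vector_derivative_def] E'] by (simp add: o_def)
    then have "((\<lambda>s. E (q s)) has_vector_derivative E' (q' s)) (at s)"
      by (simp add: has_vector_derivative_def E'.scaleR)
    then have "((\<lambda>s. of_real (E (q s)) :: 'k) has_vector_derivative of_real (E' (q' s))) (at s)"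
      by (rule bounded_linear.has_vector_derivative[OF bounded_linear_of_real])
    then show ?thesis
      by (simp add: ip has_vector_derivative_at_within)
  qed
  from fundamental_theorem_of_calculus[OF \<open>a \<le> b\<close> this] show ?thesis
    by simp
qed

text \<open>For a Lebesgue integrable integrand both integrals agree, and the endpoint
  \<open>a\<close> is negligible. The scheme itself supplies the integrability.\<close>

lemma set_integral_gradient:
  fixes ip :: "'h::banach \<Rightarrow> 'h \<Rightarrow> 'k::real_or_complex"
  assumes "is_gradient ip U E gradE" and "a \<le> b"
    and "\<And>s. (q has_vector_derivative q' s) (at s)"
    and "\<And>s. s \<in> {a..b} \<Longrightarrow> q s \<in> U"
    and int: "set_integrable lebesgue {a<..b} (\<lambda>s. ip (gradE (q s)) (q' s))"
  shows "(LINT s:{a<..b}|lebesgue. ip (gradE (q s)) (q' s)) = of_real (E (q b) - E (q a))"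
proof -
  have "((\<lambda>s. ip (gradE (q s)) (q' s)) has_integral of_real (E (q b) - E (q a))) {a<..b}"
  proof (rule has_integral_spike_set_eq[THEN iffD1, OF _ _ has_integral_gradient[OF assms(1-4)]])
    show "negligible {s \<in> {a..b} - {a<..b}. ip (gradE (q s)) (q' s) \<noteq> 0}"
      by (rule negligible_subset[of "{a}"]) auto
    show "negligible {s \<in> {a<..b} - {a..b}. ip (gradE (q s)) (q' s) \<noteq> 0}"
      by (rule negligible_subset[of "{}"]) auto
  qed
  then show ?thesis
    using set_lebesgue_integral_eq_integral(2)[OF int] by (simp add: integral_unique)
qed

section \<open>Energy balance on one mesh interval\<close>

text \<open>Integrability is a conclusion of its own because the conservation and dissipation
  arguments move linear maps through this integral.\<close>

lemma energy_balance:
  assumes hilbert: "hilbert_space smul ip"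
    and grad: "is_gradient ip U E gradE"
    and dgrad: "discrete_gradient ip U E gradE dgradE"
    and mesh: "mesh T N t"
    and sol: "dg_solution ip U gradE dgradE D L k N t u0 u p"
    and n: "n \<in> {1..N}"
  shows "set_integrable lebesgue (mesh_interval t n) (\<lambda>s. ip (L (u s) (p s)) (p s))"
    and "of_real (E (nodal t u0 u n) - E (nodal t u0 u (n - 1)))
      = (LINT s:mesh_interval t n|lebesgue. ip (L (u s) (p s)) (p s))"
proof -
  interpret hilbert_space smul ip by fact
  define a b where "a = t (n - 1)" and "b = t n"
  define J where "J = {a<..b}"
  define u' where "u' s = vector_derivative u (at s within J)" for s
  define up un where "up = right_limit u a" and "un = nodal t u0 u (n - 1)"
  have mesh_J: "mesh_interval t n = J"
    by (simp add: mesh_interval_def J_def a_def b_def)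
  have "a < b"
    using mesh n by (auto simp: mesh_def a_def b_def intro: strict_mono_onD)
  have u_poly: "u \<in> poly_on (int k) J" and p_poly: "p \<in> poly_on (int k) J"
    using sol n unfolding dg_solution_def dg_space_def mesh_J[symmetric] by blast+
  note sol_n = sol[unfolded dg_solution_def Let_def, THEN conjunct2, THEN conjunct2,
      THEN conjunct2, THEN bspec, OF n, unfolded mesh_J, folded a_def u'_def, folded up_def un_def]
  have uU: "\<And>s. s \<in> J \<Longrightarrow> u s \<in> U" and up: "up \<in> U"
    and int_u': "set_integrable lebesgue J (\<lambda>s. ip (u' s) (p s))"
    and int_L: "set_integrable lebesgue J (\<lambda>s. ip (L (u s) (p s)) (p s))"
    and eq1: "(LINT s:J|lebesgue. ip (u' s) (p s)) + ip (jump t u0 u (n - 1)) (right_limit p a)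
      = (LINT s:J|lebesgue. ip (L (u s) (p s)) (p s))"
    and eq2: "\<And>w. w \<in> poly_on (int k - 1) J \<Longrightarrow>
      set_integrable lebesgue J (\<lambda>s. ip (gradE (u s)) (w s)) \<and>
      (LINT s:J|lebesgue. ip (p s) (w s)) = (LINT s:J|lebesgue. ip (gradE (u s)) (w s))"
    and eq3: "right_limit p a = dgradE up un"
    using sol_n p_poly by blast+
  show "set_integrable lebesgue (mesh_interval t n) (\<lambda>s. ip (L (u s) (p s)) (p s))"
    using int_L by (simp add: mesh_J)
  \<comment> \<open>The discrete gradient needs both of its arguments in \<open>U\<close>. For
    \<open>n > 1\<close> the left node is the right endpoint of the preceding interval, where the
    scheme keeps \<open>u\<close> in \<open>U\<close>.\<close>
  have un: "un \<in> U"
  proof (cases "n = 1")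
    case True
    then show ?thesis
      using sol by (simp add: un_def nodal_def dg_solution_def)
  next
    case False
    then have "n - 1 \<in> {1..N}" "t (n - 1) \<in> mesh_interval t (n - 1)"
      using n mesh by (auto simp: mesh_def mesh_interval_def intro: strict_mono_onD)
    then have "u (t (n - 1)) \<in> U"
      using sol by (auto simp: dg_solution_def Let_def)
    then show ?thesis
      using False n by (auto simp: un_def nodal_def)
  qed
  obtain q q' where uq: "\<And>s. s \<in> J \<Longrightarrow> u s = q s"
    and q': "\<And>s. (q has_vector_derivative q' s) (at s)"
    and q'_poly: "q' \<in> poly_on (int k - 1) J"
    by (rule poly_on_extension[OF u_poly]) blast
  have u'q: "u' s = q' s" if "s \<in> J" for s
    unfolding u'_def J_def
    by (rule vector_derivative_within_greaterThanAtMost[OF _ _ q'])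
      (use that uq in \<open>auto simp: J_def\<close>)
  have up_q: "up = q a"
    unfolding up_def
    by (rule right_limit_eq[OF \<open>a < b\<close>])
      (use uq q' in \<open>auto simp: J_def intro: has_vector_derivative_continuous\<close>)
  have nodal_q: "nodal t u0 u n = q b"
    using uq[of b] \<open>a < b\<close> n by (simp add: nodal_def J_def b_def)
  have conj_pair: "scalar_conj (ip x y) = ip y x" for x y
    by (rule ip_conj[symmetric])
  \<comment> \<open>Conjugation swaps the arguments of \<open>ip\<close> and so puts
    \<open>p\<close> first, as in the second equation, where \<open>q'\<close> then serves as the
    test function.\<close>
  have "scalar_conj (LINT s:J|lebesgue. ip (u' s) (p s)) = (LINT s:J|lebesgue. ip (p s) (u' s))"
    using set_integral_bounded_linear[OF bounded_linear_scalar_conj int_u']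
    by (simp add: conj_pair)
  also have "\<dots> = (LINT s:J|lebesgue. ip (p s) (q' s))"
    by (rule set_lebesgue_integral_cong) (auto simp: J_def u'q[unfolded J_def])
  also have "\<dots> = (LINT s:J|lebesgue. ip (gradE (u s)) (q' s))"
    using eq2[OF q'_poly] by simp
  also have "\<dots> = (LINT s:J|lebesgue. ip (gradE (q s)) (q' s))"
    by (rule set_lebesgue_integral_cong) (auto simp: J_def uq[unfolded J_def])
  also have "\<dots> = of_real (E (q b) - E (q a))"
    unfolding J_def
  proof (rule set_integral_gradient[OF grad less_imp_le[OF \<open>a < b\<close>] q'])
    \<comment> \<open>The point \<open>a\<close> lies outside \<open>J\<close>; there
      \<open>q\<close> takes the right limit \<open>up\<close>, which the scheme also requires to be
      in \<open>U\<close>.\<close>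
    show "q s \<in> U" if "s \<in> {a..b}" for s
    proof (cases "s = a")
      case True
      then show ?thesis using up up_q by simp
    next
      case False
      then have "s \<in> J" using that by (simp add: J_def)
      then show ?thesis using uU uq by metis
    qed
    have "set_integrable lebesgue J (\<lambda>s. ip (gradE (q s)) (q' s))
        \<longleftrightarrow> set_integrable lebesgue J (\<lambda>s. ip (gradE (u s)) (q' s))"
      by (rule set_integrable_cong) (simp_all add: uq)
    then show "set_integrable lebesgue {a<..b} (\<lambda>s. ip (gradE (q s)) (q' s))"
      using eq2[OF q'_poly] by (simp add: J_def)
  qed
  finally have conj1: "scalar_conj (LINT s:J|lebesgue. ip (u' s) (p s))
      = of_real (E (q b) - E (q a))" .
  have "jump t u0 u (n - 1) = up - un"
    by (simp add: jump_def up_def un_def a_def)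
  then have "scalar_conj (ip (jump t u0 u (n - 1)) (right_limit p a)) = ip (dgradE up un) (up - un)"
    by (simp add: conj_pair eq3)
  also have "\<dots> = of_real (E up - E un)"
    using dgrad up un by (simp add: discrete_gradient_def)
  finally have conj2: "scalar_conj (ip (jump t u0 u (n - 1)) (right_limit p a))
      = of_real (E up - E un)" .
  \<comment> \<open>The two contributions telescope, since \<open>E (q a)\<close> and
    \<open>E up\<close> coincide.\<close>
  have "scalar_conj (LINT s:J|lebesgue. ip (L (u s) (p s)) (p s))
      = (of_real (E (nodal t u0 u n) - E un) :: 'a)"
    by (simp add: eq1[symmetric] scalar_conj_add conj1 conj2 up_q nodal_q del: One_nat_def)
  \<comment> \<open>The conjugated integral is real, so a second conjugation recovers the integral
    and leaves the energy difference fixed.\<close>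
  then show "of_real (E (nodal t u0 u n) - E (nodal t u0 u (n - 1)))
      = (LINT s:mesh_interval t n|lebesgue. ip (L (u s) (p s)) (p s))"
    by (metis scalar_conj_scalar_conj scalar_conj_of_real mesh_J un_def)
qed

section \<open>Conservation and dissipation from the energy balance\<close>

theorem theorem3p1:
  fixes smul :: "'k::real_or_complex \<Rightarrow> 'h::banach \<Rightarrow> 'h"
    and ip :: "'h \<Rightarrow> 'h \<Rightarrow> 'k"
    and U :: "'h set" and E :: "'h \<Rightarrow> real" and gradE :: "'h \<Rightarrow> 'h"
    and dgradE :: "'h \<Rightarrow> 'h \<Rightarrow> 'h"
    and D :: "'h \<Rightarrow> 'h set" and L :: "'h \<Rightarrow> 'h \<Rightarrow> 'h"
    and k N :: nat and T :: real and t :: "nat \<Rightarrow> real"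
    and u0 :: 'h and u p :: "real \<Rightarrow> 'h"
  assumes "hilbert_space smul ip"
    and "open U"
    and "is_gradient ip U E gradE"
    and "\<And>v. linear_operator smul (D v) (L v)"
    and "discrete_gradient ip U E gradE dgradE"
    and "T > 0"
    and "mesh T N t"
    and "\<exists>!(u, p). dg_solution ip U gradE dgradE D L k N t u0 u p"
    and "dg_solution ip U gradE dgradE D L k N t u0 u p"
  shows "(\<forall>n\<in>{1..N}.
            of_real (E (nodal t u0 u n) - E (nodal t u0 u (n - 1)))
              = (LINT s:mesh_interval t n|lebesgue. ip (L (u s) (p s)) (p s))) \<and>
         ((\<forall>v. skew_symmetric_operator ip (D v) (L v)) \<longrightarrow>
            (\<forall>n\<in>{1..N}. E (nodal t u0 u n) = E (nodal t u0 u (n - 1)))) \<and>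
         ((\<forall>v. neg_semidef_operator ip (D v) (L v)) \<longrightarrow>
            (\<forall>n\<in>{1..N}. E (nodal t u0 u n) \<le> E (nodal t u0 u (n - 1))))"
proof -
  interpret hilbert_space smul ip by fact
  note int = energy_balance(1)[OF assms(1,3,5,7,9)]
  note balance = energy_balance(2)[OF assms(1,3,5,7,9)]
  have dom: "p s \<in> D (u s)" if "n \<in> {1..N}" "s \<in> mesh_interval t n" for n s
    using assms(9) that by (auto simp: dg_solution_def Let_def)
  have "E (nodal t u0 u n) = E (nodal t u0 u (n - 1))"
    if skew: "\<forall>v. skew_symmetric_operator ip (D v) (L v)" and n: "n \<in> {1..N}" for n
  proof -
    let ?J = "mesh_interval t n" and ?f = "\<lambda>s. ip (L (u s) (p s)) (p s)"
    \<comment> \<open>Over the complex numbers skew-symmetry makes the integrand purely imaginary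
      rather than zero.\<close>
    have "?f s = - scalar_conj (?f s)" if "s \<in> ?J" for s
    proof -
      have "?f s = - ip (p s) (L (u s) (p s))"
        using skew dom[OF n that] by (simp add: skew_symmetric_operator_def)
      also have "\<dots> = - scalar_conj (?f s)"
        by (simp only: ip_conj[of "p s" "L (u s) (p s)"])
      finally show ?thesis .
    qed
    then have "(LINT s:?J|lebesgue. ?f s) = (LINT s:?J|lebesgue. - scalar_conj (?f s))"
      by (intro set_lebesgue_integral_cong) (auto simp: mesh_interval_def)
    also have "\<dots> = - scalar_conj (LINT s:?J|lebesgue. ?f s)"
      by (rule set_integral_bounded_linear
          [OF bounded_linear_minus[OF bounded_linear_scalar_conj] int[OF n]])
    \<comment> \<open>By the balance the integral is also real, so the energy difference equals its
      own negative.\<close>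
    finally have "of_real (E (nodal t u0 u n) - E (nodal t u0 u (n - 1)))
        = (of_real (- (E (nodal t u0 u n) - E (nodal t u0 u (n - 1)))) :: 'k)"
      by (simp only: balance[OF n, symmetric] scalar_conj_of_real of_real_minus)
    then show ?thesis
      by (simp only: of_real_eq_iff)
  qed
  moreover have "E (nodal t u0 u n) \<le> E (nodal t u0 u (n - 1))"
    if "\<forall>v. neg_semidef_operator ip (D v) (L v)" and n: "n \<in> {1..N}" for n
    using of_real_eq_set_integral_nonpos[OF int[OF n] balance[OF n]] that dom[OF n]
    by (auto simp: neg_semidef_operator_def)
  ultimately show ?thesis
    using balance by blast
qed

end
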